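(* For each $n\in\mathbb{N}$ let $d=d(n)\ge 1$ be an integer and $\lambda=\lambda(n)>0$ (both arbitrary). 1) Fix constants $a,b\in\mathbb{R}$ and $p\in\mathbb{N}$, $p\geq 1$, for which the polynomial kernel $\kappa(\mathbf{x},\mathbf{y})=(a\langle\mathbf{x},\mathbf{y}\rangle+b)^p$ is positive semidefinite. Any privacy mechanism which, for every database $D=(X|\mathbf{y})$ with $X\in\mathbb{R}^{n\times d}$ and $\mathbf{y}\in\{0,1\}^n$, releases the coefficient vector of the polynomial kernel ridge regression model (with kernel $\kappa$ and regularization parameter $\lambda$) fitted between $X$ and $\mathbf{y}$ by adding noise of magnitude $o\!\left(\frac{1}{d^p n+\lambda}\right)$ to each coordinate is attribute non-private. The attack achieving this violation runs in $O(dn^2)$ time. 2) Fix a constant $a>0$. Any privacy mechanism which, for every database $D=(X|\mathbf{y})$ with $X\in\mathbb{R}^{n\times d}$ and $\mathbf{y}\in\{0,1\}^n$, releases the coefficient vector of the Gaussian kernel ridge regression model (with kernel $\kappa(\mathbf{x},\mathbf{y})=\exp(-a\|\mathbf{x}-\mathbf{y}\|^2)$ and regularization parameter $\lambda$) fitted between $X$ and $\mathbf{y}$ by adding noise of magnitude $o\!\left(\frac{1}{2+\lambda}\right)$ to each coordinate is attribute non-private. The attack achieving this violation runs in $O(dn^2)$ time.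
   Context: A database is $D=(X|\mathbf{y})$, where $X\in\mathbb{R}^{n\times d}$ has rows $\mathbf{x}_1,\dots,\mathbf{x}_n$ (nonsensitive attributes, known to the attacker) and $\mathbf{y}=(y_1,\dots,y_n)\in\{0,1\}^n$ is the sensitive attribute. Kernel ridge regression: for a positive semidefinite kernel $\kappa:\mathbb{R}^d\times\mathbb{R}^d\to\mathbb{R}$ (all matrices $(\kappa(\mathbf{x}_i,\mathbf{x}_j))_{ij}$ are positive semidefinite) and $\lambda>0$, the coefficient vector of the model fitted between $X$ and $\mathbf{y}$ is $\alpha^\star=(K+\lambda\mathbb{I}_n)^{-1}\mathbf{y}\in\mathbb{R}^n$, where $K$ is the $n\times n$ matrix with $K_{ij}=\kappa(\mathbf{x}_i,\mathbf{x}_j)$ and $\mathbb{I}_n$ is the identity matrix. A (randomized) mechanism releases the coefficient vector "by adding noise of magnitude $o(\eta_n)$ to each coordinate" if on every input $(X|\mathbf{y})$ it outputs $\tilde\alpha=\alpha^\star+\mathbf{e}$, where the (random, arbitrary) noise vector $\mathbf{e}\in\mathbb{R}^n$ always satisfies $\|\mathbf{e}\|_\infty\le\beta_n$, for some sequence $\beta_n$ (the same for all inputs of size $n$) with $\beta_n/\eta_n\to 0$ as $n\to\infty$. A randomized mechanism $\mathcal{M}:\mathbb{R}^{n\times (d+1)}\to\mathbb{R}^l$ allows $(\theta,\gamma)$ attribute reconstruction if there exist $X\in\mathbb{R}^{n\times d}$ and an algorithm $\mathcal{A}:\mathbb{R}^{n\times d}\times\mathbb{R}^l\to\mathbb{R}^n$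 (the attack) such that for every $\mathbf{y}\in\{0,1\}^n$, with $\rho$ the output of $\mathcal{M}((X|\mathbf{y}))$ and $\hat{\mathbf{y}}=\mathcal{A}(X,\rho)$, one has $\Pr[d_H(\mathbf{y},\hat{\mathbf{y}})\le\theta]\ge 1-\gamma$, where $d_H$ is the Hamming distance. A mechanism (one for each $n$) is attribute non-private if there is an infinite sequence of $n$ along which it allows $(o(n),o(1))$ attribute reconstruction. Running time of the attack $\mathcal{A}$ is counted in real arithmetic operations (including evaluation of $\exp$). *)

theory Defs
  imports
    "HOL-Probability.Probability"
    "HOL-Library.Landau_Symbols"
    "Jordan_Normal_Form.Gauss_Jordan_Elimination"
begin

unbundle no vec_syntax

section \<open>Databases and kernel ridge regression\<close>

text \<open>A database \<open>(X|y)\<close> is the pair of an \<open>n\<close> by \<open>d\<close> matrix and a 0/1 vector of dimension \<open>n\<close>.\<close>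

type_synonym database = "real mat \<times> real vec"

definition binary_vecs :: "nat \<Rightarrow> real vec set" where
  "binary_vecs n = {y \<in> carrier_vec n. \<forall>i<n. y $ i \<in> {0, 1}}"

definition databases :: "nat \<Rightarrow> nat \<Rightarrow> database set" where
  "databases n d = carrier_mat n d \<times> binary_vecs n"

type_synonym kernel = "real vec \<Rightarrow> real vec \<Rightarrow> real"

definition kernel_matrix :: "kernel \<Rightarrow> real mat \<Rightarrow> real mat" where
  "kernel_matrix \<kappa> X = mat (dim_row X) (dim_row X) (\<lambda>(i, j). \<kappa> (row X i) (row X j))"

definition positive_semidefinite_mat :: "real mat \<Rightarrow> bool" where
  "positive_semidefinite_mat A \<longleftrightarrow>
     square_mat A \<and> transpose_mat A = A \<and>
     (\<forall>v \<in> carrier_vec (dim_row A). v \<bullet> (A *\<^sub>v v) \<ge> 0)"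

definition positive_semidefinite_kernel :: "nat \<Rightarrow> kernel \<Rightarrow> bool" where
  "positive_semidefinite_kernel d \<kappa> \<longleftrightarrow>
     (\<forall>m. \<forall>X \<in> carrier_mat m d. positive_semidefinite_mat (kernel_matrix \<kappa> X))"

definition polynomial_kernel :: "real \<Rightarrow> real \<Rightarrow> nat \<Rightarrow> kernel" where
  "polynomial_kernel a b p x y = (a * (x \<bullet> y) + b) ^ p"

definition gaussian_kernel :: "real \<Rightarrow> kernel" where
  "gaussian_kernel a x y = exp (- a * ((x - y) \<bullet> (x - y)))"

text \<open>
  The inverse exists whenever \<open>\<kappa>\<close> is positive semidefinite and \<open>lam > 0\<close>; the use of
  \<^const>\<open>the\<close> is then harmless.
\<close>

definition krr_coefficients :: "kernel \<Rightarrow> real \<Rightarrow> real mat \<Rightarrow> real vec \<Rightarrow> real vec" where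
  "krr_coefficients \<kappa> lam X y =
     the (mat_inverse (kernel_matrix \<kappa> X + lam \<cdot>\<^sub>m 1\<^sub>m (dim_row X))) *\<^sub>v y"

section \<open>Randomized mechanisms\<close>

text \<open>The Borel sigma-algebra on \<open>carrier_vec l\<close>, pulled back from the product space of coordinates.\<close>

definition borel_vec :: "nat \<Rightarrow> real vec measure" where
  "borel_vec l = vimage_algebra (carrier_vec l) (\<lambda>v. \<lambda>i\<in>{..<l}. v $ i) (\<Pi>\<^sub>M i\<in>{..<l}. borel)"

text \<open>A mechanism maps each input to the distribution of its output.\<close>

type_synonym mechanism = "database \<Rightarrow> real vec measure"

definition mechanism_on :: "nat \<Rightarrow> nat \<Rightarrow> nat \<Rightarrow> mechanism \<Rightarrow> bool" where
  "mechanism_on n d l M \<longleftrightarrow>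
     (\<forall>D \<in> databases n d. prob_space (M D) \<and> sets (M D) = sets (borel_vec l))"

text \<open>
  \<open>M n\<close> is the mechanism on databases with \<open>n\<close> rows, and \<open>\<eta>\<close> is the magnitude.
  The noise vector is the difference between the output and the exact coefficients; it may depend
  arbitrarily on the input, but the bound \<open>\<beta> n\<close> may not.
\<close>

definition releases_krr_with_noise ::
  "(nat \<Rightarrow> nat) \<Rightarrow> (nat \<Rightarrow> real) \<Rightarrow> kernel \<Rightarrow> (nat \<Rightarrow> real) \<Rightarrow> (nat \<Rightarrow> mechanism) \<Rightarrow> bool" where
  "releases_krr_with_noise d lam \<kappa> \<eta> M \<longleftrightarrow>
     (\<forall>n. mechanism_on n (d n) n (M n)) \<and>
     (\<exists>\<beta>. (\<lambda>n. \<beta> n / \<eta> n) \<longlonglongrightarrow> 0 \<and>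
        (\<forall>n. \<forall>(X, y) \<in> databases n (d n). AE \<rho> in M n (X, y).
           \<forall>i<n. \<bar>\<rho> $ i - krr_coefficients \<kappa> (lam n) X y $ i\<bar> \<le> \<beta> n))"

section \<open>Attribute reconstruction\<close>

definition hamming_dist :: "real vec \<Rightarrow> real vec \<Rightarrow> nat" where
  "hamming_dist y z = card {i. i < dim_vec y \<and> y $ i \<noteq> z $ i}"

type_synonym attack = "real mat \<Rightarrow> real vec \<Rightarrow> real vec"

definition reconstructs ::
  "nat \<Rightarrow> nat \<Rightarrow> nat \<Rightarrow> mechanism \<Rightarrow> real mat \<Rightarrow> attack \<Rightarrow> real \<Rightarrow> real \<Rightarrow> bool" where
  "reconstructs n d l M X A \<theta> \<gamma> \<longleftrightarrow>
     X \<in> carrier_mat n d \<and>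
     (\<forall>X' \<in> carrier_mat n d. \<forall>\<rho> \<in> carrier_vec l. A X' \<rho> \<in> carrier_vec n) \<and>
     (\<forall>y \<in> binary_vecs n.
        \<P>(\<rho> in M (X, y). real (hamming_dist y (A X \<rho>)) \<le> \<theta>) \<ge> 1 - \<gamma>)"

definition allows_attribute_reconstruction ::
  "nat \<Rightarrow> nat \<Rightarrow> nat \<Rightarrow> mechanism \<Rightarrow> real \<Rightarrow> real \<Rightarrow> bool" where
  "allows_attribute_reconstruction n d l M \<theta> \<gamma> \<longleftrightarrow>
     (\<exists>X A. reconstructs n d l M X A \<theta> \<gamma>)"

text \<open>The infinite sequence of sizes is enumerated by the strictly increasing \<open>r\<close>.\<close>

definition attribute_non_private ::
  "(nat \<Rightarrow> nat) \<Rightarrow> (nat \<Rightarrow> nat) \<Rightarrow> (nat \<Rightarrow> mechanism) \<Rightarrow> bool" where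
  "attribute_non_private d l M \<longleftrightarrow>
     (\<exists>(r :: nat \<Rightarrow> nat) \<theta> \<gamma>. strict_mono r \<and> \<theta> \<in> o(\<lambda>k. real (r k)) \<and> \<gamma> \<in> o(\<lambda>_. 1) \<and>
        (\<forall>k. allows_attribute_reconstruction (r k) (d (r k)) (l (r k)) (M (r k)) (\<theta> k) (\<gamma> k)))"

text \<open>The same violation, achieved by the given attacks, where \<open>A n\<close> is used at size \<open>n\<close>.\<close>

definition attribute_non_private_via ::
  "(nat \<Rightarrow> nat) \<Rightarrow> (nat \<Rightarrow> nat) \<Rightarrow> (nat \<Rightarrow> mechanism) \<Rightarrow> (nat \<Rightarrow> attack) \<Rightarrow> bool" where
  "attribute_non_private_via d l M A \<longleftrightarrow>
     (\<exists>(r :: nat \<Rightarrow> nat) \<theta> \<gamma>. strict_mono r \<and> \<theta> \<in> o(\<lambda>k. real (r k)) \<and> \<gamma> \<in> o(\<lambda>_. 1) \<and>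
        (\<forall>k. \<exists>X. reconstructs (r k) (d (r k)) (l (r k)) (M (r k)) X (A (r k)) (\<theta> k) (\<gamma> k)))"

lemma attribute_non_private_viaD:
  "attribute_non_private_via d l M A \<Longrightarrow> attribute_non_private d l M"
  unfolding attribute_non_private_via_def attribute_non_private_def
    allows_attribute_reconstruction_def
  by meson

section \<open>Running time: a structured real random-access machine\<close>

text \<open>
  A program works on natural-number registers, used for indices and loop counters, and on
  arrays of exact reals, which are addressed by an array name and a computed index. There is no
  conversion between the two sorts other than through control flow; in particular reals cannot be
  rounded in one step. Program constants are arbitrary reals.
\<close>

datatype iexp = IConst nat | IReg nat | IAdd iexp iexp | ISub iexp iexp | IMul iexp iexp

datatype rexp = RConst real | RLoad nat iexp
  | RAdd rexp rexp | RSub rexp rexp | RMul rexp rexp | RDiv rexp rexp | RExp rexp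

datatype bexp = RLess rexp rexp | ILess iexp iexp | BNot bexp | BAnd bexp bexp

datatype com = Skip
  | IAssign nat iexp
  | RStore nat iexp rexp
  | Seq com com
  | Cond bexp com com
  | While bexp com

record state =
  reg :: "nat \<Rightarrow> nat"
  arr :: "nat \<Rightarrow> nat \<Rightarrow> real"

fun ival :: "iexp \<Rightarrow> state \<Rightarrow> nat" where
  "ival (IConst k) s = k"
| "ival (IReg x) s = reg s x"
| "ival (IAdd e f) s = ival e s + ival f s"
| "ival (ISub e f) s = ival e s - ival f s"
| "ival (IMul e f) s = ival e s * ival f s"

fun rval :: "rexp \<Rightarrow> state \<Rightarrow> real" where
  "rval (RConst c) s = c"
| "rval (RLoad a e) s = arr s a (ival e s)"
| "rval (RAdd e f) s = rval e s + rval f s"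
| "rval (RSub e f) s = rval e s - rval f s"
| "rval (RMul e f) s = rval e s * rval f s"
| "rval (RDiv e f) s = rval e s / rval f s"
| "rval (RExp e) s = exp (rval e s)"

fun bval :: "bexp \<Rightarrow> state \<Rightarrow> bool" where
  "bval (RLess e f) s \<longleftrightarrow> rval e s < rval f s"
| "bval (ILess e f) s \<longleftrightarrow> ival e s < ival f s"
| "bval (BNot b) s \<longleftrightarrow> \<not> bval b s"
| "bval (BAnd b c) s \<longleftrightarrow> bval b s \<and> bval c s"

text \<open>
  Every node of an evaluated expression costs one unit: besides the real operations, this also
  charges for comparisons, memory accesses and index arithmetic, so that bounds on this cost are
  bounds on the number of real operations.
\<close>

fun icost :: "iexp \<Rightarrow> nat" where
  "icost (IConst k) = 1"
| "icost (IReg x) = 1"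
| "icost (IAdd e f) = 1 + icost e + icost f"
| "icost (ISub e f) = 1 + icost e + icost f"
| "icost (IMul e f) = 1 + icost e + icost f"

fun rcost :: "rexp \<Rightarrow> nat" where
  "rcost (RConst c) = 1"
| "rcost (RLoad a e) = 1 + icost e"
| "rcost (RAdd e f) = 1 + rcost e + rcost f"
| "rcost (RSub e f) = 1 + rcost e + rcost f"
| "rcost (RMul e f) = 1 + rcost e + rcost f"
| "rcost (RDiv e f) = 1 + rcost e + rcost f"
| "rcost (RExp e) = 1 + rcost e"

fun bcost :: "bexp \<Rightarrow> nat" where
  "bcost (RLess e f) = 1 + rcost e + rcost f"
| "bcost (ILess e f) = 1 + icost e + icost f"
| "bcost (BNot b) = 1 + bcost b"
| "bcost (BAnd b c) = 1 + bcost b + bcost c"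

text \<open>\<open>exec c s t s'\<close>: program \<open>c\<close>, started in \<open>s\<close>, halts in \<open>s'\<close> after \<open>t\<close> units of time.\<close>

inductive exec :: "com \<Rightarrow> state \<Rightarrow> nat \<Rightarrow> state \<Rightarrow> bool" where
  Skip: "exec Skip s 1 s"
| IAssign: "exec (IAssign x e) s (1 + icost e) (s\<lparr>reg := (reg s)(x := ival e s)\<rparr>)"
| RStore: "exec (RStore a i e) s (1 + icost i + rcost e)
    (s\<lparr>arr := (arr s)(a := (arr s a)(ival i s := rval e s))\<rparr>)"
| Seq: "exec c1 s t1 s' \<Longrightarrow> exec c2 s' t2 s'' \<Longrightarrow> exec (Seq c1 c2) s (t1 + t2) s''"
| CondTrue: "bval b s \<Longrightarrow> exec c1 s t s' \<Longrightarrow> exec (Cond b c1 c2) s (1 + bcost b + t) s'"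
| CondFalse: "\<not> bval b s \<Longrightarrow> exec c2 s t s' \<Longrightarrow> exec (Cond b c1 c2) s (1 + bcost b + t) s'"
| WhileFalse: "\<not> bval b s \<Longrightarrow> exec (While b c) s (1 + bcost b) s"
| WhileTrue: "bval b s \<Longrightarrow> exec c s t1 s' \<Longrightarrow> exec (While b c) s' t2 s'' \<Longrightarrow>
    exec (While b c) s (1 + bcost b + t1 + t2) s''"

inductive_cases exec_SkipE: "exec Skip s t s'"
inductive_cases exec_IAssignE: "exec (IAssign x e) s t s'"
inductive_cases exec_RStoreE: "exec (RStore a i e) s t s'"
inductive_cases exec_SeqE: "exec (Seq c1 c2) s t s'"
inductive_cases exec_CondE: "exec (Cond b c1 c2) s t s'"
inductive_cases exec_WhileE: "exec (While b c) s t s'"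

lemma exec_deterministic:
  "exec c s t s' \<Longrightarrow> exec c s u s'' \<Longrightarrow> u = t \<and> s'' = s'"
proof (induction arbitrary: u s'' rule: exec.induct)
  case (Skip s)
  then show ?case by (rule exec_SkipE) simp
next
  case (IAssign x e s)
  then show ?case by (rule exec_IAssignE) simp
next
  case (RStore a i e s)
  then show ?case by (rule exec_RStoreE) simp
next
  case (Seq c1 s t1 s' c2 t2 s1)
  from Seq.prems show ?case
  proof (rule exec_SeqE)
    fix v1 r v2
    assume u: "u = v1 + v2" and r: "exec c1 s v1 r" "exec c2 r v2 s''"
    from Seq.IH(1)[OF r(1)] have v1: "v1 = t1" "r = s'" by simp_all
    from Seq.IH(2)[OF r(2)[unfolded v1]] u v1 show ?thesis by simp
  qed
next
  case (CondTrue b s c1 t s' c2)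
  from CondTrue.prems show ?case
  proof (rule exec_CondE)
    fix v assume u: "u = Suc (bcost b + v)" and r: "exec c1 s v s''"
    from CondTrue.IH[OF r] u show ?thesis by simp
  next
    assume "\<not> bval b s"
    with CondTrue.hyps show ?thesis by blast
  qed
next
  case (CondFalse b s c2 t s' c1)
  from CondFalse.prems show ?case
  proof (rule exec_CondE)
    assume "bval b s"
    with CondFalse.hyps show ?thesis by blast
  next
    fix v assume u: "u = Suc (bcost b + v)" and r: "exec c2 s v s''"
    from CondFalse.IH[OF r] u show ?thesis by simp
  qed
next
  case (WhileFalse b s c)
  from WhileFalse.prems show ?case
    by (rule exec_WhileE) (use WhileFalse.hyps in simp_all)
next
  case (WhileTrue b s c t1 s' t2 s1)
  from WhileTrue.prems show ?case
  proof (rule exec_WhileE)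
    assume "\<not> bval b s"
    with WhileTrue.hyps show ?thesis by blast
  next
    fix v1 r v2
    assume u: "u = Suc (bcost b + v1 + v2)" and r: "exec c s v1 r" "exec (While b c) r v2 s''"
    from WhileTrue.IH(1)[OF r(1)] have v1: "v1 = t1" "r = s'" by simp_all
    from WhileTrue.IH(2)[OF r(2)[unfolded v1]] u v1 show ?thesis by simp
  qed
qed

text \<open>
  Input: \<open>n\<close> and \<open>d\<close> in registers 0 and 1, the regularization parameter in array 0, the matrix
  \<open>X\<close> in row-major order in array 1 and the released vector \<open>\<rho>\<close> in array 2; everything else is 0.
  The output is read off array 3.
\<close>

definition initial_state :: "nat \<Rightarrow> nat \<Rightarrow> real \<Rightarrow> real mat \<Rightarrow> real vec \<Rightarrow> state" where
  "initial_state n d lam X \<rho> =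
     \<lparr>reg = (\<lambda>_. 0)(0 := n, 1 := d),
      arr = (\<lambda>_ _. 0)
        (0 := (\<lambda>_. 0)(0 := lam),
         1 := (\<lambda>k. if k < n * d then X $$ (k div d, k mod d) else 0),
         2 := (\<lambda>k. if k < dim_vec \<rho> then \<rho> $ k else 0))\<rparr>"

definition final_output :: "nat \<Rightarrow> state \<Rightarrow> real vec" where
  "final_output n s = vec n (arr s 3)"

text \<open>
  One program computes the attacks of all sizes, and its worst-case cost over all inputs of size
  \<open>n\<close> is at most \<open>T n\<close>, with \<open>T = O(f)\<close>.
\<close>

definition attack_runs_in_time ::
  "(nat \<Rightarrow> nat) \<Rightarrow> (nat \<Rightarrow> nat) \<Rightarrow> (nat \<Rightarrow> real) \<Rightarrow> (nat \<Rightarrow> attack) \<Rightarrow> (nat \<Rightarrow> real) \<Rightarrow> bool" where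
  "attack_runs_in_time d l lam A f \<longleftrightarrow>
     (\<exists>c T. (\<lambda>n. real (T n)) \<in> O(f) \<and>
        (\<forall>n. \<forall>X \<in> carrier_mat n (d n). \<forall>\<rho> \<in> carrier_vec (l n).
           \<exists>t s. exec c (initial_state n (d n) (lam n) X \<rho>) t s \<and> t \<le> T n \<and>
             final_output n s = A n X \<rho>))"

end

theory Submission
  imports Defs "Jordan_Normal_Form.Determinant"
begin

text \<open>
  Since \<open>y = (K + \<lambda>I) \<alpha>\<close>, thresholding \<open>(K + \<lambda>I) \<rho>\<close> at 1/2 recovers \<open>y\<close> exactly as soon as the noise
  is small compared to the inverse of the largest absolute row sum of \<open>K + \<lambda>I\<close>. The database \<open>X\<close>
  may be chosen. For the polynomial kernel \<open>X = 0\<close> makes all entries of \<open>K\<close> equal to \<open>b ^ p\<close>, so the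
  row sums are \<open>O(n + \<lambda>)\<close>. For the Gaussian kernel, points at mutual distance at least \<open>sqrt (4n / a)\<close>
  bring \<open>K\<close> so close to the identity that replacing \<open>K\<close> by \<open>I\<close> changes \<open>(K + \<lambda>I) \<alpha>\<close> by at most 1/3.
  In both cases the matrix to be applied has the form \<open>c0 J + (c1 + \<lambda>) I\<close>, where \<open>J\<close> is the all-ones
  matrix, which takes linear time.
\<close>

section \<open>The attack and its running time\<close>

text \<open>The matrix \<open>X\<close> is ignored, because the attack only has to succeed on the chosen database.\<close>

definition threshold_attack :: "real \<Rightarrow> real \<Rightarrow> (nat \<Rightarrow> real) \<Rightarrow> nat \<Rightarrow> attack" where
  "threshold_attack c0 c1 lam n X \<rho> =
     vec n (\<lambda>i. if 1 / 2 < c0 * (\<Sum>j<n. \<rho> $ j) + (c1 + lam n) * \<rho> $ i then 1 else 0)"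

text \<open>The invariant is indexed by the number of completed rounds, so the loop test is decided
  by that index alone. From index \<open>k\<close> there remain \<open>n - k\<close> rounds, each
  paying for one test and one body, followed by the failing test that accounts for the trailing
  \<open>1 + bcost b\<close>. The induction runs downwards from \<open>k = n\<close>.\<close>

lemma exec_While_counting:
  assumes test: "\<And>k s. k \<le> n \<Longrightarrow> Inv k s \<Longrightarrow> bval b s \<longleftrightarrow> k < n"
    and body: "\<And>k s. k < n \<Longrightarrow> Inv k s \<Longrightarrow> \<exists>t s'. exec c s t s' \<and> t \<le> C \<and> Inv (Suc k) s'"
    and "k \<le> n" "Inv k s"
  shows "\<exists>t s'. exec (While b c) s t s' \<and> t \<le> (n - k) * (1 + bcost b + C) + 1 + bcost b \<and> Inv n s'"
  using assms(3,4)
proof (induction k arbitrary: s rule: inc_induct)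
  case base
  then have "exec (While b c) s (1 + bcost b) s"
    using test[of n s] by (intro exec.WhileFalse) auto
  with base show ?case by force
next
  case (step k)
  obtain t1 s1 where 1: "exec c s t1 s1" "t1 \<le> C" "Inv (Suc k) s1"
    using body step by blast
  obtain t2 s2 where 2: "exec (While b c) s1 t2 s2"
    "t2 \<le> (n - Suc k) * (1 + bcost b + C) + 1 + bcost b" "Inv n s2"
    using step.IH 1(3) by blast
  have "exec (While b c) s (1 + bcost b + t1 + t2) s2"
    using test[of k s] step 1 2 by (intro exec.WhileTrue) auto
  moreover have "n - k = Suc (n - Suc k)"
    using step by simp
  then have "1 + bcost b + t1 + t2 \<le> (n - k) * (1 + bcost b + C) + 1 + bcost b"
    using 1(2) 2(2) by simp
  ultimately show ?case
    using 2(3) by blast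
qed

text \<open>Register 2 is the loop counter, and entry 0 of array 4 accumulates the sum of \<open>\<rho>\<close>.\<close>

definition sum_loop :: com where
  "sum_loop = While (ILess (IReg 2) (IReg 0))
     (Seq (RStore 4 (IConst 0) (RAdd (RLoad 4 (IConst 0)) (RLoad 2 (IReg 2))))
       (IAssign 2 (IAdd (IReg 2) (IConst 1))))"

definition threshold_loop :: "real \<Rightarrow> real \<Rightarrow> com" where
  "threshold_loop c0 c1 = While (ILess (IReg 2) (IReg 0))
     (Seq
       (Cond (RLess (RConst (1 / 2))
           (RAdd (RMul (RConst c0) (RLoad 4 (IConst 0)))
             (RMul (RAdd (RConst c1) (RLoad 0 (IConst 0))) (RLoad 2 (IReg 2)))))
         (RStore 3 (IReg 2) (RConst 1))
         (RStore 3 (IReg 2) (RConst 0)))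
       (IAssign 2 (IAdd (IReg 2) (IConst 1))))"

definition threshold_program :: "real \<Rightarrow> real \<Rightarrow> com" where
  "threshold_program c0 c1 = Seq sum_loop (Seq (IAssign 2 (IConst 0)) (threshold_loop c0 c1))"

text \<open>Besides the sum, it records that n, the regularization parameter and the released vector
  survive, since the thresholding loop reads them again.\<close>

lemma exec_sum_loop:
  assumes "reg s 2 = 0" "arr s 4 0 = 0"
  shows "\<exists>t s'. exec sum_loop s t s' \<and> t \<le> 16 * reg s 0 + 4 \<and> reg s' 0 = reg s 0 \<and>
    arr s' 0 = arr s 0 \<and> arr s' 2 = arr s 2 \<and> arr s' 4 0 = (\<Sum>j<reg s 0. arr s 2 j)"
proof -
  define Inv where "Inv k s' \<longleftrightarrow> reg s' 0 = reg s 0 \<and> reg s' 2 = k \<and>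
    arr s' 0 = arr s 0 \<and> arr s' 2 = arr s 2 \<and> arr s' 4 0 = (\<Sum>j<k. arr s 2 j)" for k and s' :: state
  \<comment> \<open>The body costs 11 units, rounded up to 12. With the test a round costs at most
    16, and the last test costs 4.\<close>
  have "\<exists>t s'. exec sum_loop s t s' \<and>
      t \<le> (reg s 0 - 0) * (1 + bcost (ILess (IReg 2) (IReg 0)) + 12)
        + 1 + bcost (ILess (IReg 2) (IReg 0)) \<and> Inv (reg s 0) s'"
    unfolding sum_loop_def
  proof (rule exec_While_counting)
    fix k s' assume k: "k < reg s 0" and inv: "Inv k s'"
    show "\<exists>t s''. exec
        (Seq (RStore 4 (IConst 0) (RAdd (RLoad 4 (IConst 0)) (RLoad 2 (IReg 2))))
          (IAssign 2 (IAdd (IReg 2) (IConst 1)))) s' t s'' \<and> t \<le> 12 \<and> Inv (Suc k) s''"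
      by (intro exI conjI, rule exec.Seq, rule exec.RStore, rule exec.IAssign)
        (use inv in \<open>auto simp: Inv_def\<close>)
  qed (use assms in \<open>auto simp: Inv_def\<close>)
  then show ?thesis
    by (elim ex_forward) (simp add: Inv_def)
qed

lemma exec_threshold_loop:
  assumes "reg s 2 = 0"
  shows "\<exists>t s'. exec (threshold_loop c0 c1) s t s' \<and> t \<le> 29 * reg s 0 + 4 \<and>
    (\<forall>i<reg s 0. arr s' 3 i =
      (if 1 / 2 < c0 * arr s 4 0 + (c1 + arr s 0 0) * arr s 2 i then 1 else 0))"
proof -
  \<comment> \<open>Round \<open>k\<close> writes only entry \<open>k\<close> of array 3, so the
    outputs below \<open>k\<close> are already final.\<close>
  define Inv where "Inv k s' \<longleftrightarrow> reg s' 0 = reg s 0 \<and> reg s' 2 = k \<and>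
    arr s' 0 = arr s 0 \<and> arr s' 2 = arr s 2 \<and> arr s' 4 = arr s 4 \<and>
    (\<forall>i<k. arr s' 3 i =
      (if 1 / 2 < c0 * arr s 4 0 + (c1 + arr s 0 0) * arr s 2 i then 1 else 0))" for k and s' :: state
  let ?b = "RLess (RConst (1 / 2))
           (RAdd (RMul (RConst c0) (RLoad 4 (IConst 0)))
             (RMul (RAdd (RConst c1) (RLoad 0 (IConst 0))) (RLoad 2 (IReg 2))))"
  let ?c = "Cond ?b (RStore 3 (IReg 2) (RConst 1)) (RStore 3 (IReg 2) (RConst 0))"
  \<comment> \<open>Both branches of the body cost 22 units, below the bound 25. Adding 4 for the
    test gives 29 per round.\<close>
  have "\<exists>t s'. exec (threshold_loop c0 c1) s t s' \<and>
      t \<le> (reg s 0 - 0) * (1 + bcost (ILess (IReg 2) (IReg 0)) + 25)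
        + 1 + bcost (ILess (IReg 2) (IReg 0)) \<and> Inv (reg s 0) s'"
    unfolding threshold_loop_def
  proof (rule exec_While_counting)
    fix k s' assume k: "k < reg s 0" and inv: "Inv k s'"
    show "\<exists>t s''. exec (Seq ?c (IAssign 2 (IAdd (IReg 2) (IConst 1)))) s' t s'' \<and>
        t \<le> 25 \<and> Inv (Suc k) s''"
    proof (cases "bval ?b s'")
      case True
      show ?thesis
        by (intro exI conjI, rule exec.Seq, rule exec.CondTrue[OF _ exec.RStore], rule True,
            rule exec.IAssign)
          (use True inv in \<open>auto simp: Inv_def less_Suc_eq\<close>)
    next
      case False
      show ?thesis
        by (intro exI conjI, rule exec.Seq, rule exec.CondFalse[OF _ exec.RStore], rule False,
            rule exec.IAssign)
          (use False inv in \<open>auto simp: Inv_def less_Suc_eq\<close>)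
    qed
  qed (use assms in \<open>auto simp: Inv_def\<close>)
  then show ?thesis
    by (elim ex_forward) (simp add: Inv_def)
qed

lemma exec_threshold_program:
  assumes "\<rho> \<in> carrier_vec n"
  shows "\<exists>t s. exec (threshold_program c0 c1) (initial_state n m (lam n) X \<rho>) t s \<and>
    t \<le> 45 * n + 10 \<and> final_output n s = threshold_attack c0 c1 lam n X \<rho>"
proof -
  let ?s = "initial_state n m (lam n) X \<rho>"
  have s: "reg ?s 0 = n" "reg ?s 2 = 0" "arr ?s 0 0 = lam n" "arr ?s 4 0 = 0"
    "\<And>i. i < n \<Longrightarrow> arr ?s 2 i = \<rho> $ i"
    using assms by (auto simp: initial_state_def)
  obtain t1 s1 where 1: "exec sum_loop ?s t1 s1" "t1 \<le> 16 * n + 4" "reg s1 0 = n"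
    "arr s1 0 = arr ?s 0" "arr s1 2 = arr ?s 2" "arr s1 4 0 = (\<Sum>j<n. arr ?s 2 j)"
    using exec_sum_loop[of ?s] s by auto
  let ?s2 = "s1\<lparr>reg := (reg s1)(2 := 0)\<rparr>"
  have 2: "exec (IAssign 2 (IConst 0)) s1 (Suc (Suc 0)) ?s2"
    using exec.IAssign[of 2 "IConst 0" s1] by simp
  obtain t3 s3 where 3: "exec (threshold_loop c0 c1) ?s2 t3 s3" "t3 \<le> 29 * n + 4"
    "\<And>i. i < n \<Longrightarrow> arr s3 3 i =
      (if 1 / 2 < c0 * arr s1 4 0 + (c1 + arr s1 0 0) * arr s1 2 i then 1 else 0)"
    using exec_threshold_loop[of ?s2 c0 c1] 1(3) by auto
  \<comment> \<open>The bounds 16n + 4, 2 and 29n + 4 add up to 45n + 10.\<close>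
  have "exec (threshold_program c0 c1) ?s (t1 + (Suc (Suc 0) + t3)) s3"
    unfolding threshold_program_def using 1 2 3 by (intro exec.Seq)
  moreover have "final_output n s3 = threshold_attack c0 c1 lam n X \<rho>"
    unfolding final_output_def threshold_attack_def
    by (rule eq_vecI) (simp_all add: 1(4-6) 3(3) s)
  ultimately show ?thesis
    using 1(2) 3(2) by (intro exI[of _ "t1 + (Suc (Suc 0) + t3)"] exI[of _ s3]) auto
qed

text \<open>The cost is linear in n, and n is at most \<open>d n * n ^ 2\<close> because
  \<open>d n \<ge> 1\<close>. One program serves all sizes: \<open>c0\<close> and \<open>c1\<close>
  are program constants, while \<open>lam n\<close>, which varies with n, is read from array
  0.\<close>

lemma threshold_attack_runs_in_time:
  assumes d: "\<And>n. d n \<ge> 1"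
  shows "attack_runs_in_time d (\<lambda>n. n) lam (threshold_attack c0 c1 lam)
    (\<lambda>n. real (d n) * real n ^ 2)"
proof -
  have "(\<lambda>n. real (45 * n + 10)) \<in> O(\<lambda>n. real (d n) * real n ^ 2)"
  proof (rule bigoI[of _ 55], rule eventually_mono[OF eventually_ge_at_top[of 1]])
    fix n :: nat assume n: "1 \<le> n"
    then have "n \<le> n * n"
      by simp
    also have "\<dots> \<le> d n * (n * n)"
      using d[of n] by simp
    finally have "45 * n + 10 \<le> 55 * (d n * (n * n))"
      using n by linarith
    then have "real (45 * n + 10) \<le> real (55 * (d n * (n * n)))"
      by (rule of_nat_mono)
    then show "norm (real (45 * n + 10)) \<le> 55 * norm (real (d n) * real n ^ 2)"
      by (simp add: power2_eq_square)
  qed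
  then show ?thesis
    unfolding attack_runs_in_time_def
    by (intro exI[of _ "threshold_program c0 c1"] exI[of _ "\<lambda>n. 45 * n + 10"])
      (simp add: exec_threshold_program)
qed

section \<open>Decoding noisy coefficients\<close>

text \<open>The tuple map is measurable because \<open>borel_vec\<close> is the pullback along it; a
  coordinate is this map followed by a projection.\<close>

lemma measurable_borel_vec_nth:
  assumes "i < n"
  shows "(\<lambda>v. v $ i) \<in> borel_measurable (borel_vec n)"
proof -
  have "(\<lambda>v. \<lambda>i\<in>{..<n}. v $ i) \<in> borel_vec n \<rightarrow>\<^sub>M (\<Pi>\<^sub>M i\<in>{..<n}. borel)"
    unfolding borel_vec_def by (rule measurable_vimage_algebra1) (auto simp: space_PiM)
  then have "(\<lambda>v. (\<lambda>i\<in>{..<n}. v $ i) i) \<in> borel_measurable (borel_vec n)"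
    by (rule measurable_compose) (use assms in \<open>auto intro: measurable_component_singleton\<close>)
  then show ?thesis
    using assms by simp
qed

text \<open>Rounding a bit at 1/2 tolerates any error below 1/2. This budget is split into 1/3 for
  the approximate decoding matrix and 1/6 for the noise. The factor in front of
  \<open>\<beta>\<close> bounds the absolute row sums of that matrix, hence how much it amplifies
  noise in the sup norm.\<close>

lemma threshold_attack_eq:
  fixes \<alpha> \<rho> y :: "real vec"
  assumes y: "y \<in> binary_vecs n"
    and "0 \<le> lam n"
    and approx: "\<And>i. i < n \<Longrightarrow> \<bar>c0 * (\<Sum>j<n. \<alpha> $ j) + (c1 + lam n) * \<alpha> $ i - y $ i\<bar> \<le> 1 / 3"
    and noise: "\<And>i. i < n \<Longrightarrow> \<bar>\<rho> $ i - \<alpha> $ i\<bar> \<le> \<beta>"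
    and small: "(\<bar>c0\<bar> * n + \<bar>c1\<bar> + lam n) * \<beta> < 1 / 6"
  shows "threshold_attack c0 c1 lam n X \<rho> = y"
proof (rule eq_vecI)
  fix i assume "i < dim_vec y"
  then have i: "i < n"
    using y by (auto simp: binary_vecs_def)
  have "\<bar>\<Sum>j<n. \<rho> $ j - \<alpha> $ j\<bar> \<le> (\<Sum>j<n. \<beta>)"
    using noise by (intro order.trans[OF sum_abs sum_mono]) auto
  then have 1: "\<bar>c0 * (\<Sum>j<n. \<rho> $ j - \<alpha> $ j)\<bar> \<le> \<bar>c0\<bar> * (n * \<beta>)"
    unfolding abs_mult by (intro mult_left_mono) auto
  have "\<bar>c1 + lam n\<bar> \<le> \<bar>c1\<bar> + lam n"
    using assms(2) by linarith
  then have 2: "\<bar>(c1 + lam n) * (\<rho> $ i - \<alpha> $ i)\<bar> \<le> (\<bar>c1\<bar> + lam n) * \<beta>"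
    unfolding abs_mult using noise[OF i] assms(2) by (intro mult_mono) auto
  have "c0 * (\<Sum>j<n. \<rho> $ j) + (c1 + lam n) * \<rho> $ i
      = c0 * (\<Sum>j<n. \<alpha> $ j) + (c1 + lam n) * \<alpha> $ i
        + c0 * (\<Sum>j<n. \<rho> $ j - \<alpha> $ j) + (c1 + lam n) * (\<rho> $ i - \<alpha> $ i)"
    by (simp add: sum_subtractf algebra_simps)
  moreover have "\<bar>c0\<bar> * (n * \<beta>) + (\<bar>c1\<bar> + lam n) * \<beta> < 1 / 6"
    using small by (simp add: algebra_simps)
  ultimately have "\<bar>c0 * (\<Sum>j<n. \<rho> $ j) + (c1 + lam n) * \<rho> $ i - y $ i\<bar> < 1 / 2"
    using approx[OF i] 1 2 by linarith
  moreover have "y $ i = 0 \<or> y $ i = 1"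
    using y i by (auto simp: binary_vecs_def)
  ultimately show "threshold_attack c0 c1 lam n X \<rho> $ i = y $ i"
    using i by (auto simp: threshold_attack_def)
qed (use y in \<open>auto simp: threshold_attack_def binary_vecs_def\<close>)

text \<open>Passing from almost sure recovery to probability one requires the success event to be
  measurable.\<close>

lemma prob_threshold_attack_exact:
  assumes "prob_space P" and sets: "sets P = sets (borel_vec n)"
    and y: "y \<in> binary_vecs n"
    and ae: "AE \<rho> in P. threshold_attack c0 c1 lam n X \<rho> = y"
  shows "\<P>(\<rho> in P. real (hamming_dist y (threshold_attack c0 c1 lam n X \<rho>)) \<le> 0) = 1"
proof -
  interpret prob_space P by fact
  have dim: "dim_vec y = n"
    using y by (simp add: binary_vecs_def)
  have bin: "y $ i = 0 \<or> y $ i = 1" if "i < n" for i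
    using y that by (auto simp: binary_vecs_def)
  \<comment> \<open>Success is restated as finitely many strict linear inequalities in the
    coordinates of \<open>\<rho>\<close>, or their negations, which makes measurability
    accessible.\<close>
  define exact where "exact \<rho> \<longleftrightarrow>
    (\<forall>i\<in>{..<n}. 1 / 2 < c0 * (\<Sum>j<n. \<rho> $ j) + (c1 + lam n) * \<rho> $ i \<longleftrightarrow> y $ i = 1)" for \<rho>
  have exact: "real (hamming_dist y (threshold_attack c0 c1 lam n X \<rho>)) \<le> 0 \<longleftrightarrow> exact \<rho>" for \<rho>
  proof -
    have "real (hamming_dist y (threshold_attack c0 c1 lam n X \<rho>)) \<le> 0 \<longleftrightarrow>
        (\<forall>i\<in>{..<n}. y $ i = threshold_attack c0 c1 lam n X \<rho> $ i)"
      by (auto simp: hamming_dist_def dim)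
    also have "\<dots> \<longleftrightarrow> exact \<rho>"
      unfolding exact_def
    proof (intro ball_cong refl)
      fix i assume "i \<in> {..<n}"
      then show "y $ i = threshold_attack c0 c1 lam n X \<rho> $ i \<longleftrightarrow>
          (1 / 2 < c0 * (\<Sum>j<n. \<rho> $ j) + (c1 + lam n) * \<rho> $ i \<longleftrightarrow> y $ i = 1)"
        using bin[of i] by (auto simp: threshold_attack_def)
    qed
    finally show ?thesis .
  qed
  have "Measurable.pred P exact"
    unfolding exact_def
  proof (intro pred_intros_finite)
    have nth: "(\<lambda>\<rho>. \<rho> $ j) \<in> borel_measurable P" if "j \<in> {..<n}" for j
      unfolding measurable_cong_sets[OF sets refl]
      using that by (intro measurable_borel_vec_nth) simp
    fix i assume "i \<in> {..<n}"
    then have "(\<lambda>\<rho>. c0 * (\<Sum>j<n. \<rho> $ j) + (c1 + lam n) * \<rho> $ i) \<in> borel_measurable P"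
      by (intro borel_measurable_add borel_measurable_times borel_measurable_const
          borel_measurable_sum nth)
    then have "Measurable.pred P (\<lambda>\<rho>. 1 / 2 < c0 * (\<Sum>j<n. \<rho> $ j) + (c1 + lam n) * \<rho> $ i)"
      by (intro borel_measurable_pred_less borel_measurable_const)
    then show "Measurable.pred P (\<lambda>\<rho>.
        1 / 2 < c0 * (\<Sum>j<n. \<rho> $ j) + (c1 + lam n) * \<rho> $ i \<longleftrightarrow> y $ i = 1)"
      by (cases "y $ i = 1") auto
  qed simp
  then have "{\<rho> \<in> space P. exact \<rho>} \<in> sets P"
    by (rule predE)
  moreover have "AE \<rho> in P. exact \<rho>"
    using ae by eventually_elim (simp add: exact[symmetric] hamming_dist_def)
  ultimately show ?thesis
    unfolding exact by (rule prob_Collect_eq_1[THEN iffD2])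
qed

text \<open>As \<open>C\<close> does not depend on n, the amplified noise is at most
  \<open>C * \<bar>\<beta> n / \<eta> n\<bar>\<close>, which tends to 0 and eventually drops below
  1/6. From then on recovery is exact, so both \<open>\<theta>\<close> and \<open>\<gamma>\<close>
  can be 0.\<close>

lemma threshold_attack_violates_privacy:
  assumes rel: "releases_krr_with_noise d lam \<kappa> \<eta> M"
    and lam: "\<And>n. 0 \<le> lam n"
    and \<eta>: "\<And>n. n \<ge> 1 \<Longrightarrow> 0 < \<eta> n"
    and X: "\<And>n. X n \<in> carrier_mat n (d n)"
    and approx: "\<And>n y i. y \<in> binary_vecs n \<Longrightarrow> i < n \<Longrightarrow>
      \<bar>c0 * (\<Sum>j<n. krr_coefficients \<kappa> (lam n) (X n) y $ j)
        + (c1 + lam n) * krr_coefficients \<kappa> (lam n) (X n) y $ i - y $ i\<bar> \<le> 1 / 3"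
    and bound: "\<And>n. (\<bar>c0\<bar> * n + \<bar>c1\<bar> + lam n) * \<eta> n \<le> C"
  shows "attribute_non_private_via d (\<lambda>n. n) M (threshold_attack c0 c1 lam)"
proof -
  obtain \<beta> where mech: "\<And>n. mechanism_on n (d n) n (M n)"
    and \<beta>: "(\<lambda>n. \<beta> n / \<eta> n) \<longlonglongrightarrow> 0"
    and noise: "\<And>n X y. (X, y) \<in> databases n (d n) \<Longrightarrow>
      AE \<rho> in M n (X, y). \<forall>i<n. \<bar>\<rho> $ i - krr_coefficients \<kappa> (lam n) X y $ i\<bar> \<le> \<beta> n"
    using rel unfolding releases_krr_with_noise_def by fast
  have "(\<lambda>n. C * \<bar>\<beta> n / \<eta> n\<bar>) \<longlonglongrightarrow> 0"
    using tendsto_mult[OF tendsto_const tendsto_rabs[OF \<beta>], of C] by simp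
  then have "eventually (\<lambda>n. C * \<bar>\<beta> n / \<eta> n\<bar> < 1 / 6) sequentially"
    by (rule order_tendstoD) simp
  then obtain N where N: "\<And>n. n \<ge> N \<Longrightarrow> C * \<bar>\<beta> n / \<eta> n\<bar> < 1 / 6"
    by (auto simp: eventually_sequentially)
  have "reconstructs n (d n) n (M n) (X n) (threshold_attack c0 c1 lam n) 0 0"
    if n: "n \<ge> N" "n \<ge> 1" for n
    unfolding reconstructs_def
  proof (intro conjI ballI)
    fix y assume y: "y \<in> binary_vecs n"
    then have db: "(X n, y) \<in> databases n (d n)"
      using X by (simp add: databases_def)
    \<comment> \<open>The absolute value is taken because the sign of \<open>\<beta> n\<close> is
      not assumed.\<close>
    have "(\<bar>c0\<bar> * n + \<bar>c1\<bar> + lam n) * \<bar>\<beta> n\<bar>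
        = ((\<bar>c0\<bar> * n + \<bar>c1\<bar> + lam n) * \<eta> n) * \<bar>\<beta> n / \<eta> n\<bar>"
      using \<eta>[of n] n by (simp add: abs_divide)
    also have "\<dots> \<le> C * \<bar>\<beta> n / \<eta> n\<bar>"
      by (rule mult_right_mono[OF bound]) simp
    also have "\<dots> < 1 / 6"
      using N n by simp
    finally have small: "(\<bar>c0\<bar> * n + \<bar>c1\<bar> + lam n) * \<bar>\<beta> n\<bar> < 1 / 6" .
    have exact: "threshold_attack c0 c1 lam n (X n) \<rho> = y"
      if noise_le: "\<forall>i<n. \<bar>\<rho> $ i - krr_coefficients \<kappa> (lam n) (X n) y $ i\<bar> \<le> \<beta> n" for \<rho>
    proof (rule threshold_attack_eq[where \<alpha> = "krr_coefficients \<kappa> (lam n) (X n) y"])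
      fix i assume "i < n"
      with noise_le show "\<bar>\<rho> $ i - krr_coefficients \<kappa> (lam n) (X n) y $ i\<bar> \<le> \<bar>\<beta> n\<bar>"
        by (meson abs_ge_self order.trans)
    qed (fact y lam small approx[OF y])+
    have "AE \<rho> in M n (X n, y). threshold_attack c0 c1 lam n (X n) \<rho> = y"
      using noise[OF db] by eventually_elim (rule exact)
    then show "1 - 0 \<le> \<P>(\<rho> in M n (X n, y).
        real (hamming_dist y (threshold_attack c0 c1 lam n (X n) \<rho>)) \<le> 0)"
      using mech[of n] db y by (subst prob_threshold_attack_exact) (auto simp: mechanism_on_def)
  qed (use X in \<open>auto simp: threshold_attack_def\<close>)
  \<comment> \<open>The shift by \<open>Suc N\<close> skips the sizes below \<open>N\<close> and
    also size 0, where \<open>\<eta>\<close> need not be positive.\<close>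
  then have "\<exists>X. reconstructs (k + Suc N) (d (k + Suc N)) (k + Suc N) (M (k + Suc N)) X
      (threshold_attack c0 c1 lam (k + Suc N)) 0 0" for k
    by (intro exI[of _ "X (k + Suc N)"]) simp
  then show ?thesis
    unfolding attribute_non_private_via_def
    by (intro exI[of _ "\<lambda>k. k + Suc N"] exI[of _ "\<lambda>_. 0"] conjI allI)
      (auto simp: strict_mono_def)
qed

section \<open>Databases with an explicit kernel matrix\<close>

text \<open>A trivial null space makes the determinant nonzero, so \<open>mat_inverse\<close>
  returns \<open>Some\<close> and the value of \<open>the\<close> is a genuine inverse. Injectivity
  is left as a hypothesis: it comes from semidefiniteness for the polynomial kernel and from
  closeness to the identity for the Gaussian one.\<close>

lemma krr_coefficients_solve:
  assumes X: "X \<in> carrier_mat n m" and y: "y \<in> carrier_vec n"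
    and inj: "\<And>v. v \<in> carrier_vec n \<Longrightarrow>
      (kernel_matrix \<kappa> X + l \<cdot>\<^sub>m 1\<^sub>m n) *\<^sub>v v = 0\<^sub>v n \<Longrightarrow> v = 0\<^sub>v n"
  shows "krr_coefficients \<kappa> l X y \<in> carrier_vec n"
    and "(kernel_matrix \<kappa> X + l \<cdot>\<^sub>m 1\<^sub>m n) *\<^sub>v krr_coefficients \<kappa> l X y = y"
proof -
  let ?A = "kernel_matrix \<kappa> X + l \<cdot>\<^sub>m 1\<^sub>m n"
  have A: "?A \<in> carrier_mat n n"
    using X by (auto simp: kernel_matrix_def)
  have "det ?A \<noteq> 0"
    using inj det_0_iff_vec_prod_zero[OF A] by blast
  then have "?A \<in> Units (ring_mat TYPE(real) n ())"
    by (rule det_non_zero_imp_unit[OF A])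
  then obtain B where some: "mat_inverse ?A = Some B"
    using mat_inverse(1)[OF A, of "()"] by (cases "mat_inverse ?A") auto
  note B = mat_inverse(2)[OF A some]
  have eq: "krr_coefficients \<kappa> l X y = B *\<^sub>v y"
    using X some by (simp add: krr_coefficients_def)
  show "krr_coefficients \<kappa> l X y \<in> carrier_vec n"
    using B y by (auto simp: eq)
  show "?A *\<^sub>v krr_coefficients \<kappa> l X y = y"
    using B y A by (simp add: eq assoc_mult_mat_vec[symmetric, of _ n n _ n])
qed

lemma regularized_kernel_mult_nth:
  assumes X: "X \<in> carrier_mat n m" and v: "v \<in> carrier_vec n" and i: "i < n"
  shows "((kernel_matrix \<kappa> X + l \<cdot>\<^sub>m 1\<^sub>m n) *\<^sub>v v) $ i =
    (\<Sum>j<n. \<kappa> (row X i) (row X j) * v $ j) + l * v $ i"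
proof -
  have "((kernel_matrix \<kappa> X + l \<cdot>\<^sub>m 1\<^sub>m n) *\<^sub>v v) $ i =
      (\<Sum>j<n. (\<kappa> (row X i) (row X j) + l * (if i = j then 1 else 0)) * v $ j)"
    using X v i by (auto simp: kernel_matrix_def scalar_prod_def atLeast0LessThan intro!: sum.cong)
  also have "\<dots> = (\<Sum>j<n. \<kappa> (row X i) (row X j) * v $ j + (if i = j then l * v $ j else 0))"
    by (intro sum.cong) (auto simp: algebra_simps)
  also have "\<dots> = (\<Sum>j<n. \<kappa> (row X i) (row X j) * v $ j) + l * v $ i"
    using i by (simp add: sum.distrib)
  finally show ?thesis .
qed

text \<open>Pairing the equation with \<open>v\<close> gives 0 as the sum of the nonnegative terms
  \<open>v \<bullet> (K *\<^sub>v v)\<close> and \<open>l * (v \<bullet> v)\<close>, so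
  \<open>v \<bullet> v\<close> vanishes.\<close>

lemma psd_regularized_injective:
  assumes K: "K \<in> carrier_mat n n" and psd: "positive_semidefinite_mat K" and l: "0 < l"
    and v: "v \<in> carrier_vec n" and zero: "(K + l \<cdot>\<^sub>m 1\<^sub>m n) *\<^sub>v v = 0\<^sub>v n"
  shows "v = 0\<^sub>v n"
proof -
  have "(K + l \<cdot>\<^sub>m 1\<^sub>m n) *\<^sub>v v = K *\<^sub>v v + (l \<cdot>\<^sub>m 1\<^sub>m n) *\<^sub>v v"
    using K v by (intro add_mult_distrib_mat_vec[of _ n n]) auto
  also have "(l \<cdot>\<^sub>m 1\<^sub>m n) *\<^sub>v v = l \<cdot>\<^sub>v v"
    using v by (intro eq_vecI) auto
  finally have "0 = v \<bullet> (K *\<^sub>v v + l \<cdot>\<^sub>v v)"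
    using zero v by (metis scalar_prod_right_zero)
  also have "\<dots> = v \<bullet> (K *\<^sub>v v) + l * (v \<bullet> v)"
    using K v by (subst scalar_prod_add_distrib[of _ n]) auto
  finally have "l * (v \<bullet> v) \<le> 0"
    using psd K v by (auto simp: positive_semidefinite_mat_def)
  then have "v \<bullet> v \<le> 0"
    using l by (simp add: mult_le_0_iff)
  moreover have "v \<bullet> v = (\<Sum>i<n. (v $ i)\<^sup>2)"
    using v by (auto simp: scalar_prod_def atLeast0LessThan power2_eq_square)
  ultimately have "(\<Sum>i<n. (v $ i)\<^sup>2) = 0"
    by (simp add: antisym sum_nonneg)
  then have "\<forall>i<n. v $ i = 0"
    by (simp add: sum_nonneg_eq_0_iff)
  with v show ?thesis
    by (intro eq_vecI) auto
qed

section \<open>The polynomial kernel on the zero matrix\<close>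

lemma krr_polynomial_zero_mat:
  assumes psd: "positive_semidefinite_kernel m (polynomial_kernel a b p)" and l: "0 < l"
    and y: "y \<in> carrier_vec n" and i: "i < n"
  defines "\<alpha> \<equiv> krr_coefficients (polynomial_kernel a b p) l (0\<^sub>m n m) y"
  shows "b ^ p * (\<Sum>j<n. \<alpha> $ j) + l * \<alpha> $ i = y $ i"
proof -
  let ?\<kappa> = "polynomial_kernel a b p" and ?X = "0\<^sub>m n m :: real mat"
  have X: "?X \<in> carrier_mat n m"
    by simp
  have K: "kernel_matrix ?\<kappa> ?X \<in> carrier_mat n n"
    by (simp add: kernel_matrix_def)
  have "positive_semidefinite_mat (kernel_matrix ?\<kappa> ?X)"
    using psd X unfolding positive_semidefinite_kernel_def by blast
  note inj = psd_regularized_injective[OF K this l]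
  note \<alpha> = krr_coefficients_solve[OF X y, of ?\<kappa> l, OF inj, folded \<alpha>_def]
  have "y $ i = (\<Sum>j<n. ?\<kappa> (row ?X i) (row ?X j) * \<alpha> $ j) + l * \<alpha> $ i"
    using regularized_kernel_mult_nth[OF X \<alpha>(1) i, of ?\<kappa> l] \<alpha>(2) by simp
  \<comment> \<open>All inner products of rows vanish, leaving only the offset \<open>b\<close>
    inside the power.\<close>
  also have "(\<Sum>j<n. ?\<kappa> (row ?X i) (row ?X j) * \<alpha> $ j) = (\<Sum>j<n. b ^ p * \<alpha> $ j)"
    using i by (intro sum.cong) (auto simp: polynomial_kernel_def)
  finally show ?thesis
    by (simp add: sum_distrib_left)
qed

section \<open>The Gaussian kernel on well separated points\<close>

text \<open>The off-diagonal part of a row contributes at most \<open>\<epsilon>\<close> times the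
  l1 norm of \<open>v\<close>. Since \<open>1 + l \<ge> 1\<close>, summing over the rows bounds the
  norm of \<open>v\<close> by that of \<open>w\<close> plus \<open>n * \<epsilon>\<close> times
  itself, and \<open>n * \<epsilon> \<le> 1 / 4\<close> lets the last term be absorbed. The case
  \<open>w = 0\<close> yields injectivity.\<close>

lemma l1_bound_near_identity:
  fixes k :: "nat \<Rightarrow> nat \<Rightarrow> real" and v w :: "real vec"
  assumes diag: "\<And>i. i < n \<Longrightarrow> k i i = 1"
    and off: "\<And>i j. i < n \<Longrightarrow> j < n \<Longrightarrow> i \<noteq> j \<Longrightarrow> \<bar>k i j\<bar> \<le> \<epsilon>"
    and \<epsilon>: "0 \<le> \<epsilon>" "n * \<epsilon> \<le> 1 / 4" and l: "0 \<le> l"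
    and eq: "\<And>i. i < n \<Longrightarrow> (\<Sum>j<n. k i j * v $ j) + l * v $ i = w $ i"
  shows "\<And>i. i < n \<Longrightarrow> \<bar>(1 + l) * v $ i - w $ i\<bar> \<le> \<epsilon> * (\<Sum>j<n. \<bar>v $ j\<bar>)"
    and "3 / 4 * (\<Sum>j<n. \<bar>v $ j\<bar>) \<le> (\<Sum>j<n. \<bar>w $ j\<bar>)"
proof -
  let ?S = "\<Sum>j<n. \<bar>v $ j\<bar>"
  have S: "0 \<le> ?S"
    by (simp add: sum_nonneg)
  show close: "\<bar>(1 + l) * v $ i - w $ i\<bar> \<le> \<epsilon> * ?S" if i: "i < n" for i
  proof -
    have "(\<Sum>j<n. k i j * v $ j) = v $ i + (\<Sum>j\<in>{..<n} - {i}. k i j * v $ j)"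
      using i diag by (simp add: sum.remove[of _ i])
    then have "\<bar>(1 + l) * v $ i - w $ i\<bar> = \<bar>\<Sum>j\<in>{..<n} - {i}. k i j * v $ j\<bar>"
      using eq[OF i] by (simp add: algebra_simps)
    also have "\<dots> \<le> (\<Sum>j\<in>{..<n} - {i}. \<epsilon> * \<bar>v $ j\<bar>)"
      using off i
      by (intro order.trans[OF sum_abs sum_mono]) (auto simp: abs_mult intro!: mult_right_mono)
    also have "\<dots> \<le> (\<Sum>j<n. \<epsilon> * \<bar>v $ j\<bar>)"
      using \<epsilon> by (intro sum_mono2) auto
    finally show ?thesis
      by (simp add: sum_distrib_left)
  qed
  have "?S \<le> (\<Sum>i<n. \<bar>w $ i\<bar> + \<epsilon> * ?S)"
  proof (rule sum_mono)
    fix i assume "i \<in> {..<n}"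
    then have "\<bar>(1 + l) * v $ i\<bar> \<le> \<bar>w $ i\<bar> + \<epsilon> * ?S"
      using close[of i] by auto
    moreover have "1 * \<bar>v $ i\<bar> \<le> \<bar>(1 + l) * v $ i\<bar>"
      unfolding abs_mult using l by (intro mult_right_mono) auto
    ultimately show "\<bar>v $ i\<bar> \<le> \<bar>w $ i\<bar> + \<epsilon> * ?S"
      by simp
  qed
  also have "\<dots> = (\<Sum>i<n. \<bar>w $ i\<bar>) + (n * \<epsilon>) * ?S"
    by (simp add: sum.distrib)
  also have "\<dots> \<le> (\<Sum>i<n. \<bar>w $ i\<bar>) + 1 / 4 * ?S"
    using \<epsilon> S by (intro add_left_mono mult_right_mono)
  finally show "3 / 4 * ?S \<le> (\<Sum>j<n. \<bar>w $ j\<bar>)"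
    by simp
qed

text \<open>The points lie on the first coordinate axis, so every dimension \<open>m \<ge> 1\<close>
  is covered. The spacing cancels \<open>a\<close> in the exponent, leaving 4n times the squared
  index difference.\<close>

definition spread_mat :: "real \<Rightarrow> nat \<Rightarrow> nat \<Rightarrow> real mat" where
  "spread_mat a n m = mat n m (\<lambda>(i, j). if j = 0 then real i * sqrt (4 * n / a) else 0)"

lemma gaussian_kernel_spread_mat:
  assumes a: "0 < a" and m: "1 \<le> m" and ij: "i < n" "j < n"
  shows "gaussian_kernel a (row (spread_mat a n m) i) (row (spread_mat a n m) j) =
    exp (- (4 * n * (real i - real j)\<^sup>2))"
proof -
  let ?x = "row (spread_mat a n m) i - row (spread_mat a n m) j"
  have "?x \<bullet> ?x = (\<Sum>k<m. if k = 0 then ((real i - real j) * sqrt (4 * n / a))\<^sup>2 else 0)"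
    unfolding scalar_prod_def using ij
    by (intro sum.cong) (auto simp: spread_mat_def power2_eq_square algebra_simps)
  also have "\<dots> = (real i - real j)\<^sup>2 * (4 * n / a)"
    using m a by (simp add: power_mult_distrib)
  finally show ?thesis
    using a by (simp add: gaussian_kernel_def algebra_simps)
qed

text \<open>A binary \<open>y\<close> has l1 norm at most n, so \<open>\<alpha>\<close> has l1 norm
  at most 4n/3. Replacing the kernel matrix by the identity then costs at most
  \<open>\<epsilon> * (4 / 3 * n)\<close>, which is at most 1/3.\<close>

lemma krr_gaussian_spread_mat:
  assumes a: "0 < a" and m: "1 \<le> m" and l: "0 < l" and y: "y \<in> binary_vecs n" and i: "i < n"
  defines "\<alpha> \<equiv> krr_coefficients (gaussian_kernel a) l (spread_mat a n m) y"
  shows "\<bar>(1 + l) * \<alpha> $ i - y $ i\<bar> \<le> 1 / 3"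
proof -
  let ?X = "spread_mat a n m"
  define k where "k i j = gaussian_kernel a (row ?X i) (row ?X j)" for i j
  define \<epsilon> where "\<epsilon> = exp (- (4 * real n))"
  have X: "?X \<in> carrier_mat n m"
    by (simp add: spread_mat_def)
  have yc: "y \<in> carrier_vec n"
    using y by (simp add: binary_vecs_def)
  have diag: "k i i = 1" if "i < n" for i
    using gaussian_kernel_spread_mat[OF a m that that] by (simp add: k_def)
  have off: "\<bar>k i j\<bar> \<le> \<epsilon>" if "i < n" "j < n" "i \<noteq> j" for i j
  proof -
    have "1 \<le> \<bar>real i - real j\<bar>"
      using that by linarith
    then have "1 \<le> (real i - real j)\<^sup>2"
      by (simp add: abs_le_square_iff[of 1, simplified])
    then have "4 * real n * 1 \<le> 4 * real n * (real i - real j)\<^sup>2"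
      by (intro mult_left_mono) auto
    then show ?thesis
      unfolding k_def gaussian_kernel_spread_mat[OF a m that(1,2)] by (simp add: \<epsilon>_def)
  qed
  \<comment> \<open>This is where the factor 4 in the spacing pays off: it gives
    \<open>n * \<epsilon> \<le> 1 / 4\<close>.\<close>
  have "4 * real n \<le> exp (4 * real n)"
    using exp_ge_add_one_self[of "4 * real n"] by linarith
  then have \<epsilon>: "0 \<le> \<epsilon>" "n * \<epsilon> \<le> 1 / 4"
    by (auto simp: \<epsilon>_def exp_minus field_simps)
  have inj: "v = 0\<^sub>v n" if v: "v \<in> carrier_vec n"
    and zero: "(kernel_matrix (gaussian_kernel a) ?X + l \<cdot>\<^sub>m 1\<^sub>m n) *\<^sub>v v = 0\<^sub>v n" for v
  proof -
    have "(\<Sum>j<n. k i j * v $ j) + l * v $ i = (0\<^sub>v n :: real vec) $ i" if "i < n" for i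
      using regularized_kernel_mult_nth[OF X v that, of "gaussian_kernel a" l] zero
      by (simp add: k_def)
    from l1_bound_near_identity(2)[OF diag off \<epsilon> less_imp_le[OF l] this]
    have "3 / 4 * (\<Sum>j<n. \<bar>v $ j\<bar>) \<le> 0"
      by simp
    then have "(\<Sum>j<n. \<bar>v $ j\<bar>) = 0"
      by (simp add: antisym sum_nonneg)
    then have "\<forall>i<n. v $ i = 0"
      by (simp add: sum_nonneg_eq_0_iff)
    with v show ?thesis
      by (intro eq_vecI) auto
  qed
  note \<alpha> = krr_coefficients_solve[OF X yc, of "gaussian_kernel a" l, OF inj, folded \<alpha>_def]
  have eq: "(\<Sum>j<n. k i j * \<alpha> $ j) + l * \<alpha> $ i = y $ i" if "i < n" for i
    using regularized_kernel_mult_nth[OF X \<alpha>(1) that, of "gaussian_kernel a" l] \<alpha>(2)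
    by (simp add: k_def)
  have close: "\<bar>(1 + l) * \<alpha> $ i - y $ i\<bar> \<le> \<epsilon> * (\<Sum>j<n. \<bar>\<alpha> $ j\<bar>)"
    and bound: "3 / 4 * (\<Sum>j<n. \<bar>\<alpha> $ j\<bar>) \<le> (\<Sum>j<n. \<bar>y $ j\<bar>)"
    by (rule l1_bound_near_identity[OF diag off \<epsilon> less_imp_le[OF l] eq]; (assumption | rule i))+
  have "(\<Sum>j<n. \<bar>y $ j\<bar>) \<le> (\<Sum>j<n. 1)"
    using y by (intro sum_mono) (auto simp: binary_vecs_def)
  then have "(\<Sum>j<n. \<bar>\<alpha> $ j\<bar>) \<le> 4 / 3 * n"
    using bound by simp
  then have "\<epsilon> * (\<Sum>j<n. \<bar>\<alpha> $ j\<bar>) \<le> \<epsilon> * (4 / 3 * n)"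
    using \<epsilon> by (intro mult_left_mono)
  with close \<epsilon> show ?thesis
    by (simp add: algebra_simps)
qed

section \<open>Both kernels combined\<close>

theorem proposition4p2:
  fixes d :: "nat \<Rightarrow> nat" and lam :: "nat \<Rightarrow> real"
  assumes d: "\<And>n. d n \<ge> 1" and lam: "\<And>n. lam n > 0"
  shows
    "(\<forall>(a::real) (b::real) (p::nat) M.
        p \<ge> 1 \<longrightarrow>
        (\<forall>n. positive_semidefinite_kernel (d n) (polynomial_kernel a b p)) \<longrightarrow>
        releases_krr_with_noise d lam (polynomial_kernel a b p)
          (\<lambda>n. 1 / (real (d n) ^ p * real n + lam n)) M \<longrightarrow>
        attribute_non_private d (\<lambda>n. n) M \<and>
        (\<exists>A. attribute_non_private_via d (\<lambda>n. n) M A \<and>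
             attack_runs_in_time d (\<lambda>n. n) lam A (\<lambda>n. real (d n) * real n ^ 2)))
     \<and>
     (\<forall>(a::real) M.
        a > 0 \<longrightarrow>
        releases_krr_with_noise d lam (gaussian_kernel a)
          (\<lambda>n. 1 / (2 + lam n)) M \<longrightarrow>
        attribute_non_private d (\<lambda>n. n) M \<and>
        (\<exists>A. attribute_non_private_via d (\<lambda>n. n) M A \<and>
             attack_runs_in_time d (\<lambda>n. n) lam A (\<lambda>n. real (d n) * real n ^ 2)))"
proof -
  note lam_nonneg = less_imp_le[OF lam]
  have poly: "attribute_non_private_via d (\<lambda>n. n) M (threshold_attack (b ^ p) 0 lam)"
    if psd: "\<forall>n. positive_semidefinite_kernel (d n) (polynomial_kernel a b p)"
      and rel: "releases_krr_with_noise d lam (polynomial_kernel a b p)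
        (\<lambda>n. 1 / (real (d n) ^ p * real n + lam n)) M" for a b p M
  proof (rule threshold_attack_violates_privacy[OF rel lam_nonneg])
    fix n
    have den: "0 < real (d n) ^ p * real n + lam n"
      using lam[of n] by (intro add_nonneg_pos) auto
    then show "0 < 1 / (real (d n) ^ p * real n + lam n)"
      by simp
    \<comment> \<open>The row sums involve n and not \<open>d n ^ p * n\<close>, so
      \<open>d n \<ge> 1\<close> is used to compare them with the noise scale. The resulting
      constant is \<open>\<bar>b ^ p\<bar> + 1\<close>.\<close>
    have "1 * real n \<le> real (d n) ^ p * real n"
      using d[of n] by (intro mult_right_mono one_le_power) auto
    then have "\<bar>b ^ p\<bar> * real n \<le> \<bar>b ^ p\<bar> * (real (d n) ^ p * real n)"
      by (intro mult_left_mono) auto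
    moreover have "0 \<le> \<bar>b ^ p\<bar> * lam n" "0 \<le> real (d n) ^ p * real n"
      using lam_nonneg by auto
    ultimately have "\<bar>b ^ p\<bar> * real n + \<bar>0\<bar> + lam n
        \<le> (\<bar>b ^ p\<bar> + 1) * (real (d n) ^ p * real n + lam n)"
      unfolding distrib_right distrib_left by linarith
    then show "(\<bar>b ^ p\<bar> * real n + \<bar>0\<bar> + lam n) * (1 / (real (d n) ^ p * real n + lam n))
        \<le> \<bar>b ^ p\<bar> + 1"
      using den by (simp add: divide_le_eq)
    show "0\<^sub>m n (d n) \<in> carrier_mat n (d n)"
      by simp
    fix y i assume "y \<in> binary_vecs n" "i < n"
    then show "\<bar>b ^ p * (\<Sum>j<n. krr_coefficients (polynomial_kernel a b p) (lam n) (0\<^sub>m n (d n)) y $ j)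
        + (0 + lam n) * krr_coefficients (polynomial_kernel a b p) (lam n) (0\<^sub>m n (d n)) y $ i
        - y $ i\<bar> \<le> 1 / 3"
      using krr_polynomial_zero_mat[OF psd[rule_format] lam, of y n i] by (simp add: binary_vecs_def)
  qed
  \<comment> \<open>Decoding just multiplies by \<open>1 + lam n\<close>, which is below
    \<open>2 + lam n\<close>, so the constant is 1.\<close>
  have gauss: "attribute_non_private_via d (\<lambda>n. n) M (threshold_attack 0 1 lam)"
    if a: "0 < a" and rel: "releases_krr_with_noise d lam (gaussian_kernel a)
      (\<lambda>n. 1 / (2 + lam n)) M" for a M
  proof (rule threshold_attack_violates_privacy[OF rel lam_nonneg])
    fix n
    show "0 < 1 / (2 + lam n)" "(\<bar>0\<bar> * real n + \<bar>1\<bar> + lam n) * (1 / (2 + lam n)) \<le> 1"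
      using lam[of n] by (auto simp: divide_le_eq)
    show "spread_mat a n (d n) \<in> carrier_mat n (d n)"
      by (simp add: spread_mat_def)
    fix y i assume "y \<in> binary_vecs n" "i < n"
    from krr_gaussian_spread_mat[OF a d lam this]
    show "\<bar>0 * (\<Sum>j<n. krr_coefficients (gaussian_kernel a) (lam n) (spread_mat a n (d n)) y $ j)
        + (1 + lam n) * krr_coefficients (gaussian_kernel a) (lam n) (spread_mat a n (d n)) y $ i
        - y $ i\<bar> \<le> 1 / 3"
      by simp
  qed
  note time = threshold_attack_runs_in_time[of d, OF d]
  show ?thesis
  proof (rule conjI; intro allI impI)
    fix a b p M
    assume "\<forall>n. positive_semidefinite_kernel (d n) (polynomial_kernel a b p)"
      and "releases_krr_with_noise d lam (polynomial_kernel a b p)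
        (\<lambda>n. 1 / (real (d n) ^ p * real n + lam n)) M"
    from poly[OF this] time
    show "attribute_non_private d (\<lambda>n. n) M \<and>
        (\<exists>A. attribute_non_private_via d (\<lambda>n. n) M A \<and>
             attack_runs_in_time d (\<lambda>n. n) lam A (\<lambda>n. real (d n) * real n ^ 2))"
      by (intro conjI exI) (rule attribute_non_private_viaD)
  next
    fix a M
    assume "(0::real) < a"
      and "releases_krr_with_noise d lam (gaussian_kernel a) (\<lambda>n. 1 / (2 + lam n)) M"
    from gauss[OF this] time
    show "attribute_non_private d (\<lambda>n. n) M \<and>
        (\<exists>A. attribute_non_private_via d (\<lambda>n. n) M A \<and>
             attack_runs_in_time d (\<lambda>n. n) lam A (\<lambda>n. real (d n) * real n ^ 2))"
      by (intro conjI exI) (rule attribute_non_private_viaD)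
  qed
qed

end
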